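(* Let $r : \mathbb{S}^2 \to \mathbb{R}$ be a continuous function on the surface of the sphere. Then for every $\epsilon > 0$ there exists a neural star domain $f_{NN} \circ \omega : \mathbb{S}^2 \to \mathbb{R}$, i.e. there exists a neural network $f_{NN} : \mathbb{R}^3 \to \mathbb{R}$, such that for every ${\bf d} \in \mathbb{S}^2$, $$\left| r({\bf d}) - f_{NN}(\omega({\bf d})) \right| < \epsilon .$$
   Context: $\mathbb{S}^2$ is the unit two-dimensional sphere with its usual topology. Its points are described by spherical coordinates ${\bf d} = (\theta, \phi)$, with $\theta \in [0,\pi]$ the polar angle and $\phi \in [0, 2\pi)$ the azimuthal angle. The map $\omega : \mathbb{S}^2 \to \mathbb{R}^3$ sends a point to its Cartesian coordinates on the unit sphere: $$\omega({\bf d}) = (\sin\theta\cos\phi,\ \sin\theta\sin\phi,\ \cos\theta).$$ Thus $\omega$ is the standard embedding of the sphere in $\mathbb{R}^3$, and continuity of $r$ means continuity as a function on the sphere. A neural network $f_{NN} : \mathbb{R}^3 \to \mathbb{R}$ is a feedforward fully connected network (multilayer perceptron) with ReLU activation, of arbitrary finite depth and finite widths. That is, it is a function of the form $A_k \circ \sigma \circ A_{k-1} \circ \cdots \circ \sigma \circ A_1$, where $k \geq 2$, each $A_j : \mathbb{R}^{n_{j-1}} \to \mathbb{R}^{n_j}$ is an affine map with $n_0 = 3$ and $n_k = 1$, the hidden widths $n_1,\dots,n_{k-1}$ are arbitrary positive integers, and $\sigma$ applies $t \mapsto \max(t,0)$ to each coordinate. A neural star domain (NSD) is a function of the form $f_{NN}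 \circ \omega : \mathbb{S}^2 \to \mathbb{R}$, where $f_{NN} : \mathbb{R}^3 \to \mathbb{R}$ is a neural network. *)

theory Defs
  imports "HOL-Analysis.Analysis"
begin

section \<open>The sphere and its spherical coordinates\<close>

definition S2 :: "(real ^ 3) set" where
  "S2 = sphere 0 1"

definition polar :: "real ^ 3 \<Rightarrow> real" where
  "polar d = arccos (d $ 3)"

text \<open>At the two poles, where the azimuth is not determined, this gives \<open>0\<close>.\<close>

definition azimuth :: "real ^ 3 \<Rightarrow> real" where
  "azimuth d = Arg2pi (Complex (d $ 1) (d $ 2))"

definition cartesian :: "real \<Rightarrow> real \<Rightarrow> real ^ 3" where
  "cartesian \<theta> \<phi> = vector [sin \<theta> * cos \<phi>, sin \<theta> * sin \<phi>, cos \<theta>]"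

definition omega :: "real ^ 3 \<Rightarrow> real ^ 3" where
  "omega d = cartesian (polar d) (azimuth d)"

lemma polar_range: "d \<in> S2 \<Longrightarrow> polar d \<in> {0..pi}"
  unfolding S2_def polar_def
  using component_le_norm_cart[of d 3] by (simp add: arccos_lbound arccos_ubound)

lemma azimuth_range: "azimuth d \<in> {0..<2 * pi}"
  unfolding azimuth_def using Arg2pi[of "Complex (d $ 1) (d $ 2)"] by (simp only: atLeastLessThan_iff)

text \<open>The chosen angles are spherical coordinates of the point, so \<open>omega\<close> is the
  standard embedding.\<close>

lemma omega_S2:
  assumes "d \<in> S2"
  shows "omega d = d"
proof -
  let ?z = "Complex (d $ 1) (d $ 2)"
  have sq: "(d $ 1)\<^sup>2 + (d $ 2)\<^sup>2 + (d $ 3)\<^sup>2 = 1"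
    using assms by (simp add: S2_def norm_eq_1 inner_vec_def sum_3 power2_eq_square)
  have b: "\<bar>d $ 3\<bar> \<le> 1"
    using assms component_le_norm_cart[of d 3] by (simp add: S2_def)
  have "1 - (d $ 3)\<^sup>2 = (d $ 1)\<^sup>2 + (d $ 2)\<^sup>2"
    using sq by linarith
  then have s: "sin (polar d) = cmod ?z"
    using b by (simp add: polar_def sin_arccos_abs complex_norm)
  have 1: "sin (polar d) * cos (azimuth d) = d $ 1"
    unfolding s azimuth_def cos_Arg2pi by simp
  have 2: "sin (polar d) * sin (azimuth d) = d $ 2"
    unfolding s azimuth_def sin_Arg2pi by simp
  have 3: "cos (polar d) = d $ 3"
    using b by (simp add: polar_def cos_arccos_abs)
  show ?thesis
    unfolding omega_def cartesian_def vec_eq_iff forall_3 vector_3 1 2 3 by blast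
qed

section \<open>ReLU networks\<close>

text \<open>Since the widths vary from layer to layer, a vector in \<open>\<real>\<^sup>m\<close> is represented by a function
  \<open>nat \<Rightarrow> real\<close> of which only the values at indices \<open>< m\<close> are meaningful. An affine map
  never reads its argument outside that range, and nothing is required of its result
  at indices \<open>\<ge> n\<close>.\<close>

definition affine_map :: "nat \<Rightarrow> nat \<Rightarrow> ((nat \<Rightarrow> real) \<Rightarrow> (nat \<Rightarrow> real)) \<Rightarrow> bool" where
  "affine_map m n A \<longleftrightarrow>
     (\<exists>W b. \<forall>x. \<forall>i<n. A x i = (\<Sum>j<m. W i j * x j) + b i)"

definition relu :: "(nat \<Rightarrow> real) \<Rightarrow> (nat \<Rightarrow> real)" where
  "relu x = (\<lambda>i. max (x i) 0)"

primrec hidden :: "(nat \<Rightarrow> (nat \<Rightarrow> real) \<Rightarrow> (nat \<Rightarrow> real)) \<Rightarrow> nat \<Rightarrow> (nat \<Rightarrow> real) \<Rightarrow> (nat \<Rightarrow> real)" where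
  "hidden A 0 = id"
| "hidden A (Suc j) = relu \<circ> A (Suc j) \<circ> hidden A j"

text \<open>\<open>A k \<circ> relu \<circ> A (k - 1) \<circ> \<dots> \<circ> relu \<circ> A 1\<close>\<close>

definition mlp :: "(nat \<Rightarrow> (nat \<Rightarrow> real) \<Rightarrow> (nat \<Rightarrow> real)) \<Rightarrow> nat \<Rightarrow> (nat \<Rightarrow> real) \<Rightarrow> (nat \<Rightarrow> real)" where
  "mlp A k = A k \<circ> hidden A (k - 1)"

definition coords :: "real ^ 3 \<Rightarrow> (nat \<Rightarrow> real)" where
  "coords x = (\<lambda>i. if i = 0 then x $ 1 else if i = 1 then x $ 2 else x $ 3)"

definition neural_network :: "(real ^ 3 \<Rightarrow> real) \<Rightarrow> bool" where
  "neural_network f \<longleftrightarrow>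
     (\<exists>k n A. k \<ge> 2 \<and> n 0 = 3 \<and> n k = 1 \<and> (\<forall>j\<in>{1..<k}. n j > 0) \<and>
        (\<forall>j\<in>{1..k}. affine_map (n (j - 1)) (n j) (A j)) \<and>
        (\<forall>x. f x = mlp A k (coords x) 0))"

definition neural_star_domain :: "(real ^ 3 \<Rightarrow> real) \<Rightarrow> (real ^ 3 \<Rightarrow> real)" where
  "neural_star_domain f = f \<circ> omega"

end

theory Submission
  imports Defs
begin

text \<open>One hidden layer is enough. The span of the functions \<open>x \<mapsto> exp (w \<bullet> x)\<close> is a
  point-separating algebra, hence uniformly dense in the continuous functions on a compact set by
  Stone-Weierstrass. Each such function factors through a real variable, in which it is
  approximated by a piecewise linear function, that is, by a sum of ReLUs.\<close>

section \<open>Sums of ReLUs in one real variable\<close>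

text \<open>The domain is an arbitrary inner product space because such sums are needed both on
  \<open>real\<close> and on \<open>real ^ 3\<close>.\<close>

inductive relu_sum :: "('a::real_inner \<Rightarrow> real) \<Rightarrow> bool" where
  unit: "relu_sum (\<lambda>x. a * max (w \<bullet> x + b) 0)"
| add: "relu_sum f \<Longrightarrow> relu_sum g \<Longrightarrow> relu_sum (\<lambda>x. f x + g x)"

lemma relu_sum_const: "relu_sum (\<lambda>x. c)"
  using relu_sum.unit[of c 0 1] by simp

lemma relu_sum_inner: "relu_sum g \<Longrightarrow> relu_sum (\<lambda>x. g (w \<bullet> x))"
proof (induction rule: relu_sum.induct)
  case (unit a v b)
  then show ?case
    using relu_sum.unit[of a "v *\<^sub>R w" b] by simp
qed (rule relu_sum.add)

text \<open>Induction over the nodes builds the piecewise linear interpolant of \<open>h\<close>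
  from left to right. Keeping it constant beyond the last node lets the next step add a ramp there
  without disturbing what is already built.\<close>

lemma relu_sum_interpolation:
  fixes h :: "real \<Rightarrow> real"
  assumes "d > 0" "\<epsilon> > 0"
    and h: "\<And>s t. s \<in> {l..l + n * d} \<Longrightarrow> t \<in> {l..l + n * d} \<Longrightarrow> \<bar>s - t\<bar> \<le> d \<Longrightarrow> \<bar>h s - h t\<bar> < \<epsilon>"
    and "m \<le> n"
  shows "\<exists>g. relu_sum g \<and> (\<forall>t\<ge>l + real m * d. g t = h (l + m * d)) \<and>
           (\<forall>t\<in>{l..l + m * d}. \<bar>h t - g t\<bar> < \<epsilon>)"
  using \<open>m \<le> n\<close>
proof (induction m)
  case 0
  show ?case
    by (rule exI[of _ "\<lambda>_. h l"]) (use relu_sum_const \<open>\<epsilon> > 0\<close> in auto)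
next
  case (Suc m)
  define p q where "p = l + m * d" and "q = l + Suc m * d"
  have "real (Suc m) * d \<le> n * d"
    using Suc.prems \<open>d > 0\<close> by (intro mult_right_mono) auto
  then have pq: "q = p + d" "l \<le> p" "q \<le> l + n * d"
    using \<open>d > 0\<close> by (auto simp: p_def q_def algebra_simps)
  obtain g where g: "relu_sum g" "\<And>t. t \<ge> p \<Longrightarrow> g t = h p"
      "\<And>t. t \<in> {l..p} \<Longrightarrow> \<bar>h t - g t\<bar> < \<epsilon>"
    using Suc unfolding p_def by auto
  \<comment> \<open>\<open>s\<close> is the slope of the chord from \<open>p\<close> to
    \<open>q\<close>. The two units added below form a ramp that is 0 up to \<open>p\<close>, rises
    with slope \<open>s\<close>, and stays at \<open>h q - h p\<close> from \<open>q\<close> on;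
    writing \<open>1 \<bullet> t\<close> gives them the shape of \<open>unit\<close>.\<close>
  define s where "s = (h q - h p) / d"
  define g' where "g' t = g t + (s * max (1 \<bullet> t + - p) 0 + - s * max (1 \<bullet> t + - q) 0)" for t
  have "relu_sum g'"
    unfolding g'_def by (intro relu_sum.intros g)
  moreover have "g' t = h q" if "t \<ge> q" for t
    using that g(2)[of t] pq \<open>d > 0\<close> by (simp add: g'_def s_def field_simps)
  moreover have "\<bar>h t - g' t\<bar> < \<epsilon>" if t: "t \<in> {l..q}" for t
  proof (cases "t \<le> p")
    case True
    then show ?thesis
      using g(3)[of t] t pq \<open>d > 0\<close> by (simp add: g'_def)
  next
    case False
    define u where "u = (t - p) / d"
    have u: "0 \<le> u" "u \<le> 1"
      using False t pq \<open>d > 0\<close> by (auto simp: u_def)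
    have eq: "g' t = (1 - u) *\<^sub>R h p + u *\<^sub>R h q"
      using False t pq g(2)[of t] \<open>d > 0\<close>
      by (simp add: g'_def s_def u_def field_simps)
    \<comment> \<open>Both nodes are within \<open>d\<close> of \<open>t\<close>, so both values lie
      in the ball around \<open>h t\<close>, and by convexity so does their combination
      \<open>g' t\<close>.\<close>
    have "h p \<in> ball (h t) \<epsilon>" "h q \<in> ball (h t) \<epsilon>"
      using h[of t p] h[of t q] False t pq \<open>d > 0\<close> by (auto simp: dist_real_def)
    then have "g' t \<in> ball (h t) \<epsilon>"
      unfolding eq using u by (intro convexD[OF convex_ball]) auto
    then show ?thesis
      by (simp add: dist_real_def)
  qed
  ultimately show ?case
    unfolding q_def by blast
qed

lemma relu_sum_dense_real:
  fixes h :: "real \<Rightarrow> real"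
  assumes "continuous_on {l..u} h" "l < u" "\<epsilon> > 0"
  shows "\<exists>g. relu_sum g \<and> (\<forall>t\<in>{l..u}. \<bar>h t - g t\<bar> < \<epsilon>)"
proof -
  have "uniformly_continuous_on {l..u} h"
    using assms(1) by (intro compact_uniformly_continuous) auto
  then obtain \<delta> where "\<delta> > 0"
    and \<delta>: "\<And>s t. s \<in> {l..u} \<Longrightarrow> t \<in> {l..u} \<Longrightarrow> \<bar>s - t\<bar> < \<delta> \<Longrightarrow> \<bar>h s - h t\<bar> < \<epsilon>"
    using \<open>\<epsilon> > 0\<close> unfolding uniformly_continuous_on_def dist_real_def by metis
  \<comment> \<open>This makes the mesh width \<open>(u - l) / n\<close> strictly smaller than
    \<open>\<delta>\<close>.\<close>
  obtain n :: nat where n: "(u - l) / \<delta> < n"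
    using reals_Archimedean2 by blast
  have "n > 0"
    using n \<open>l < u\<close> \<open>\<delta> > 0\<close> by (cases n) (auto simp: field_simps)
  define d where "d = (u - l) / n"
  have d: "d > 0" "d < \<delta>" "l + n * d = u"
    using n \<open>n > 0\<close> \<open>l < u\<close> \<open>\<delta> > 0\<close> by (auto simp: d_def field_simps)
  then show ?thesis
    using relu_sum_interpolation[of d \<epsilon> l n h n] \<delta> \<open>\<epsilon> > 0\<close> by auto
qed

section \<open>Density of sums of exponentials\<close>

text \<open>A product of two exponential units is again a unit, with the weights added. ReLU sums
  are in general not closed under products, so Stone-Weierstrass does not apply to them
  directly.\<close>

inductive exp_sum :: "('a::real_inner \<Rightarrow> real) \<Rightarrow> bool" where
  unit: "exp_sum (\<lambda>x. c * exp (w \<bullet> x))"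
| add: "exp_sum f \<Longrightarrow> exp_sum g \<Longrightarrow> exp_sum (\<lambda>x. f x + g x)"

lemma exp_sum_const: "exp_sum (\<lambda>x. c)"
  using exp_sum.unit[of c 0] by simp

lemma exp_sum_mult_unit: "exp_sum f \<Longrightarrow> exp_sum (\<lambda>x. f x * (c * exp (w \<bullet> x)))"
proof (induction rule: exp_sum.induct)
  case (unit b v)
  show ?case
    using exp_sum.unit[of "b * c" "v + w"] by (simp add: inner_add_left exp_add mult_ac)
next
  case (add f g)
  then show ?case
    using exp_sum.add[OF add.IH] by (simp add: distrib_right)
qed

lemma exp_sum_mult: "exp_sum g \<Longrightarrow> exp_sum f \<Longrightarrow> exp_sum (\<lambda>x. f x * g x)"
proof (induction rule: exp_sum.induct)
  case (unit c w)
  then show ?case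
    by (rule exp_sum_mult_unit)
next
  case (add g h)
  then show ?case
    using exp_sum.add[OF add.IH] by (simp add: distrib_left)
qed

lemma continuous_on_exp_sum: "exp_sum f \<Longrightarrow> continuous_on S f"
  by (induction rule: exp_sum.induct) (intro continuous_intros; assumption)+

lemma exp_sum_dense:
  fixes r :: "'a::real_inner \<Rightarrow> real"
  assumes "compact S" "continuous_on S r" "\<epsilon> > 0"
  shows "\<exists>f. exp_sum f \<and> (\<forall>x\<in>S. \<bar>r x - f x\<bar> < \<epsilon>)"
proof (rule Stone_Weierstrass_HOL)
  fix x y :: 'a
  assume "x \<in> S \<and> y \<in> S \<and> x \<noteq> y"
  \<comment> \<open>The weight \<open>x - y\<close> separates the two points: its inner products
    with them differ by the squared distance, and \<open>exp\<close> is injective.\<close>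
  then have "(x - y) \<bullet> (x - y) \<noteq> 0"
    by simp
  then have "(x - y) \<bullet> x \<noteq> (x - y) \<bullet> y"
    by (simp add: inner_diff_right)
  then show "\<exists>f. exp_sum f \<and> f x \<noteq> f y"
    using exp_sum.unit[of 1 "x - y"] by (intro exI[of _ "\<lambda>z. 1 * exp ((x - y) \<bullet> z)"]) simp
qed (use assms exp_sum_const continuous_on_exp_sum exp_sum.add exp_sum_mult in auto)

section \<open>Density of sums of ReLUs on compact sets\<close>

lemma relu_sum_dense_ridge:
  fixes S :: "'a::real_inner set" and h :: "real \<Rightarrow> real"
  assumes "compact S" "continuous_on UNIV h" "\<epsilon> > 0"
  shows "\<exists>g. relu_sum g \<and> (\<forall>x\<in>S. \<bar>h (w \<bullet> x) - g x\<bar> < \<epsilon>)"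
proof -
  have "compact ((\<bullet>) w ` S)"
    using \<open>compact S\<close> by (intro compact_continuous_image continuous_intros)
  \<comment> \<open>The values \<open>w \<bullet> x\<close> stay in \<open>{-M..M}\<close>, so
    approximating \<open>h\<close> on that interval suffices; \<open>M > 0\<close> keeps it
    nondegenerate.\<close>
  then obtain M where "M > 0" and M: "\<And>x. x \<in> S \<Longrightarrow> \<bar>w \<bullet> x\<bar> \<le> M"
    by (metis bounded_pos compact_imp_bounded imageI real_norm_def)
  obtain g where "relu_sum g" "\<forall>t\<in>{-M..M}. \<bar>h t - g t\<bar> < \<epsilon>"
    using relu_sum_dense_real[of "-M" M h \<epsilon>] \<open>M > 0\<close> \<open>\<epsilon> > 0\<close>
      continuous_on_subset[OF assms(2)] by auto
  then show ?thesis
    using M relu_sum_inner[of g w] by (fastforce simp: abs_le_iff)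
qed

text \<open>Each term is a function of \<open>w \<bullet> x\<close> alone. An addition halves the
  tolerance, hence the induction over arbitrary \<open>\<epsilon>\<close>.\<close>

lemma relu_sum_dense_exp_sum:
  assumes "compact S" "exp_sum f" "\<epsilon> > 0"
  shows "\<exists>g. relu_sum g \<and> (\<forall>x\<in>S. \<bar>f x - g x\<bar> < \<epsilon>)"
  using assms(2,3)
proof (induction arbitrary: \<epsilon> rule: exp_sum.induct)
  case (unit c w)
  have "continuous_on UNIV (\<lambda>t. c * exp t)"
    by (intro continuous_intros)
  from relu_sum_dense_ridge[OF \<open>compact S\<close> this unit] show ?case .
next
  case (add f1 f2)
  obtain g1 g2 where g1: "relu_sum g1" "\<forall>x\<in>S. \<bar>f1 x - g1 x\<bar> < \<epsilon> / 2"
      and g2: "relu_sum g2" "\<forall>x\<in>S. \<bar>f2 x - g2 x\<bar> < \<epsilon> / 2"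
    using add.IH[of "\<epsilon> / 2"] \<open>\<epsilon> > 0\<close> by auto
  have "\<bar>f1 x + f2 x - (g1 x + g2 x)\<bar> < \<epsilon>" if "x \<in> S" for x
    using bspec[OF g1(2) that] bspec[OF g2(2) that] by linarith
  with relu_sum.add[OF g1(1) g2(1)] show ?case
    by blast
qed

lemma relu_sum_dense:
  fixes r :: "'a::real_inner \<Rightarrow> real"
  assumes "compact S" "continuous_on S r" "\<epsilon> > 0"
  shows "\<exists>g. relu_sum g \<and> (\<forall>x\<in>S. \<bar>r x - g x\<bar> < \<epsilon>)"
proof -
  obtain f where f: "exp_sum f" "\<forall>x\<in>S. \<bar>r x - f x\<bar> < \<epsilon> / 2"
    using exp_sum_dense[of S r "\<epsilon> / 2"] assms by auto
  obtain g where g: "relu_sum g" "\<forall>x\<in>S. \<bar>f x - g x\<bar> < \<epsilon> / 2"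
    using relu_sum_dense_exp_sum[OF assms(1) f(1), of "\<epsilon> / 2"] assms by auto
  have "\<bar>r x - g x\<bar> < \<epsilon>" if "x \<in> S" for x
    using bspec[OF f(2) that] bspec[OF g(2) that] by linarith
  with g(1) show ?thesis
    by blast
qed

section \<open>From sums of ReLUs to networks\<close>

lemma sum_lessThan_add:
  fixes f :: "nat \<Rightarrow> 'a::comm_monoid_add"
  shows "sum f {..<m + n} = sum f {..<m} + (\<Sum>i<n. f (m + i))"
  by (induction n) (auto simp: add.assoc)

text \<open>The weights of a network are read off from these indexed families; \<open>m > 0\<close>
  is recorded because hidden widths must be positive.\<close>

lemma relu_sum_normal_form:
  assumes "relu_sum f"
  shows "\<exists>m>0. \<exists>a w b. \<forall>x. f x = (\<Sum>i<m::nat. a i * max (w i \<bullet> x + b i) 0)"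
  using assms
proof (induction rule: relu_sum.induct)
  case (unit a w b)
  show ?case
    by (rule exI[of _ 1], rule conjI, simp, rule exI[of _ "\<lambda>_. a"], rule exI[of _ "\<lambda>_. w"],
        rule exI[of _ "\<lambda>_. b"]) simp
next
  case (add f g)
  obtain m a w b where "m > 0" and f: "\<And>x. f x = (\<Sum>i<m::nat. a i * max (w i \<bullet> x + b i) 0)"
    using add.IH(1) by blast
  obtain n a' w' b' where g: "\<And>x. g x = (\<Sum>i<n::nat. a' i * max (w' i \<bullet> x + b' i) 0)"
    using add.IH(2) by blast
  \<comment> \<open>Concatenation of two families: the second one starts at index
    \<open>m\<close>.\<close>
  let ?join = "\<lambda>u v i. if i < m then u i else v (i - m)"
  have "f x + g x = (\<Sum>i<m + n. ?join a a' i * max (?join w w' i \<bullet> x + ?join b b' i) 0)" for x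
    by (simp add: sum_lessThan_add f g)
  then show ?case
    using \<open>m > 0\<close>
    by - (rule exI[of _ "m + n"], rule conjI, simp, rule exI[of _ "?join a a'"],
        rule exI[of _ "?join w w'"], rule exI[of _ "?join b b'"], rule allI)
qed

text \<open>A hidden layer of width \<open>m\<close> computes the units, with \<open>w i\<close> as
  row \<open>i\<close> of its matrix and \<open>b\<close> as bias; the output layer adds them up
  with weights \<open>a\<close> and bias 0.\<close>

lemma neural_network_relu_sum:
  assumes "relu_sum f"
  shows "neural_network f"
proof -
  obtain m a w b where "m > 0" and f: "\<And>x. f x = (\<Sum>i<m::nat. a i * max (w i \<bullet> x + b i) 0)"
    using relu_sum_normal_form[OF assms] by blast
  define n :: "nat \<Rightarrow> nat" where "n j = (if j = 0 then 3 else if j = 1 then m else 1)" for j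
  \<comment> \<open>All indices \<open>j\<close> other than 1 get the output layer, whose value is
    the same for every \<open>i\<close>; only \<open>A 2\<close> at index 0 is read.\<close>
  define A where "A j x i = (if j = 1 then (\<Sum>k<3. coords (w i) k * x k) + b i
                             else (\<Sum>k<m. a k * x k) + 0)" for j :: nat and x i
  have "affine_map (n 0) (n 1) (A 1)"
    unfolding affine_map_def n_def A_def
    by (rule exI[of _ "\<lambda>i. coords (w i)"]) auto
  moreover have "affine_map (n 1) (n 2) (A 2)"
    unfolding affine_map_def n_def A_def
    by (rule exI[of _ "\<lambda>i. a"], rule exI[of _ "\<lambda>i. 0"]) auto
  moreover have "{1..2} = {1, 2::nat}" "{1..<2} = {1::nat}"
    by auto
  moreover have "(\<Sum>k<3. coords (w i) k * coords x k) = w i \<bullet> x" for i x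
    by (simp add: coords_def numeral_3_eq_3 inner_vec_def sum_3[unfolded numeral_3_eq_3])
  then have "mlp A 2 (coords x) 0 = f x" for x
    by (simp add: mlp_def relu_def A_def f)
  ultimately show ?thesis
    unfolding neural_network_def
    using \<open>m > 0\<close> by (intro exI[of _ 2] exI[of _ n] exI[of _ A]) (auto simp: n_def)
qed

theorem mainTheorem1:
  fixes r :: "real ^ 3 \<Rightarrow> real"
  assumes "continuous_on S2 r"
  shows "\<forall>\<epsilon>>0. \<exists>f_NN. neural_network f_NN \<and>
           (\<forall>d\<in>S2. \<bar>r d - neural_star_domain f_NN d\<bar> < \<epsilon>)"
proof (intro allI impI)
  fix \<epsilon> :: real
  assume "\<epsilon> > 0"
  have "compact S2"
    by (simp add: S2_def)
  then obtain g where "relu_sum g" "\<forall>x\<in>S2. \<bar>r x - g x\<bar> < \<epsilon>"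
    using relu_sum_dense assms \<open>\<epsilon> > 0\<close> by blast
  \<comment> \<open>On the sphere \<open>omega\<close> is the identity, so the bound for
    \<open>g\<close> is already the bound for \<open>g \<circ> omega\<close>.\<close>
  then show "\<exists>f_NN. neural_network f_NN \<and>
               (\<forall>d\<in>S2. \<bar>r d - neural_star_domain f_NN d\<bar> < \<epsilon>)"
    using neural_network_relu_sum by (auto simp: neural_star_domain_def omega_S2)
qed

end
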